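(* Let $s,N\ge1$ and let $q,\widetilde q\in\mathfrak A_{s,N}$ satisfy $q(0)=\widetilde q(0)=O_s$. Define $\psi=(e_0-q)^{(-1)}$ and $\widetilde\psi=(e_0-\widetilde q)^{(-1)}$. Then $$\widetilde\psi-\psi=\widetilde\psi*(\widetilde q-q)*\psi,$$ and $$\|\widetilde\psi-\psi\|_{1,N}\le\|\widetilde\psi\|_{1,N}\,\|\widetilde q-q\|_{1,N}\,\|\psi\|_{1,N}.$$ Let $d\ge1$, let $L,\widetilde L\in\mathfrak P_{s,d,N}$, and set $M=\psi*L$ and $\widetilde M=\widetilde\psi*\widetilde L$. Then $$\|\widetilde M-M\|_{1,N}\le\|\widetilde\psi-\psi\|_{1,N}\|L\|_{1,N}+\|\widetilde\psi\|_{1,N}\|\widetilde L-L\|_{1,N}.$$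
   Context: $\mathfrak A_{s,N}=\mathbb C^{s\times s}[x]/\langle x^N\rangle$ is the ring of truncated matrix polynomials; its elements are identified with finite sequences $(A(0),\ldots,A(N-1))$ of $s\times s$ complex matrices. $\mathfrak P_{r,p,N}=\{\sum_{k=0}^{N-1}A_kx^k:A_k\in\mathbb C^{r\times p}\}$, similarly identified with sequences of $r\times p$ matrices. The product $*$ (for compatible dimensions) is $(A*B)(k)=\sum_{\ell=0}^kA(\ell)B(k-\ell)$ for $0\le k\le N-1$, truncated after coefficient $N-1$. $e_0$ is the identity: $e_0(0)=I_s$, $e_0(k)=O_s$ (zero matrix) for $k\ge1$. $(\cdot)^{(-1)}$ is the two-sided inverse in $\mathfrak A_{s,N}$ (an element is invertible when its zero-order coefficient is nonsingular). The norm is $\|A\|_{1,N}=\sum_{k=0}^{N-1}\|A(k)\|_2$, with $\|\cdot\|_2$ the spectral norm. *)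

theory Defs
  imports "HOL-Analysis.Analysis"
begin

text \<open>
  A matrix with rows indexed by \<open>'r\<close> and columns indexed by \<open>'p\<close> has type
  \<open>complex ^ 'p ^ 'r\<close>.  A truncated matrix polynomial \<open>\<Sum>k<N. A k * x^k\<close> is encoded by its
  coefficient function, which vanishes from index \<open>N\<close> on; so equality of functions is equality
  of the coefficients \<open>0, \<dots>, N - 1\<close>, and pointwise subtraction is subtraction of polynomials.
\<close>

definition trunc_polys :: "nat \<Rightarrow> (nat \<Rightarrow> complex ^ 'p ^ 'r) set" where
  "trunc_polys N = {A. \<forall>k\<ge>N. A k = 0}"

definition trunc_mult ::
  "(nat \<Rightarrow> complex ^ 'p ^ 'r) \<Rightarrow> nat \<Rightarrow> (nat \<Rightarrow> complex ^ 't ^ 'p) \<Rightarrow> (nat \<Rightarrow> complex ^ 't ^ 'r)"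
  ("(_ \<star>\<^bsub>_\<^esub> _)" [70, 0, 71] 70) where
  "A \<star>\<^bsub>N\<^esub> B = (\<lambda>k. if k < N then \<Sum>l\<le>k. A l ** B (k - l) else 0)"

text \<open>Lies in \<open>trunc_polys N\<close>, and is the identity there, as soon as \<open>N \<ge> 1\<close>.\<close>

definition e0 :: "nat \<Rightarrow> complex ^ 's ^ 's" where
  "e0 k = (if k = 0 then mat 1 else 0)"

text \<open>The two-sided inverse; unspecified if \<open>A\<close> is not invertible.\<close>

definition trunc_inv :: "nat \<Rightarrow> (nat \<Rightarrow> complex ^ 's ^ 's) \<Rightarrow> (nat \<Rightarrow> complex ^ 's ^ 's)" where
  "trunc_inv N A = (THE B. B \<in> trunc_polys N \<and> A \<star>\<^bsub>N\<^esub> B = e0 \<and> B \<star>\<^bsub>N\<^esub> A = e0)"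

text \<open>The norm on \<open>complex ^ 'n\<close> is the Euclidean one, so this is the induced 2-norm.\<close>

definition spectral_norm :: "complex ^ 'p ^ 'r \<Rightarrow> real" where
  "spectral_norm A = onorm (\<lambda>v. A *v v)"

definition norm1 :: "nat \<Rightarrow> (nat \<Rightarrow> complex ^ 'p ^ 'r) \<Rightarrow> real" where
  "norm1 N A = (\<Sum>k<N. spectral_norm (A k))"

end

theory Submission
  imports Defs
begin

text \<open>The first claim is a resolvent identity: multiplying
  \<open>(e0 - q) - (e0 - q') = q' - q\<close> by \<psi>' on the left and by \<psi> on the right
  leaves \<psi>' - \<psi>. This rests on the ring laws of the truncated product (chiefly
  \<open>trunc_mult_assoc\<close>) and on \<psi>, \<psi>' being genuine inverses. Since
  \<open>e0 - q\<close> has zero-order coefficient \<open>mat 1\<close>, the equations for the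
  coefficients of a right inverse form a triangular system, solved recursively in
  \<open>trunc_right_inverse_exists\<close>; \<open>trunc_inv_props\<close> turns this into a unique
  two-sided inverse. Both bounds then follow from submultiplicativity of the norm
  (\<open>norm1_mult\<close>), the second one after splitting M' - M into a term with \<psi>' -
  \<psi> and a term with L' - L.\<close>

lemma matrix_add_rdistrib:
  fixes A B :: "'a::semiring_1 ^ 'p ^ 'r"
  shows "(A + B) ** C = A ** C + B ** C"
  by (vector matrix_matrix_mult_def sum.distrib[symmetric] field_simps)

lemma matrix_mul_sum_left:
  fixes B :: "'a::semiring_1 ^ 't ^ 'p"
  shows "(\<Sum>i\<in>S. A i) ** B = (\<Sum>i\<in>S. A i ** B)"
  by (induction S rule: infinite_finite_induct) (simp_all add: matrix_add_rdistrib)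

lemma matrix_mul_sum_right:
  fixes A :: "'a::semiring_1 ^ 'p ^ 'r"
  shows "A ** (\<Sum>i\<in>S. B i) = (\<Sum>i\<in>S. A ** B i)"
  by (induction S rule: infinite_finite_induct) (simp_all add: matrix_add_ldistrib)

lemma matrix_mul_diff_left:
  fixes A B :: "'a::ring_1 ^ 'p ^ 'r"
  shows "(A - B) ** C = A ** C - B ** C"
  by (metis add_diff_cancel diff_add_cancel matrix_add_rdistrib)

lemma matrix_mul_diff_right:
  fixes A :: "'a::ring_1 ^ 'p ^ 'r"
  shows "A ** (B - C) = A ** B - A ** C"
  by (metis add_diff_cancel diff_add_cancel matrix_add_ldistrib)

lemma trunc_mult_diff_left: "(A - B) \<star>\<^bsub>N\<^esub> C = A \<star>\<^bsub>N\<^esub> C - B \<star>\<^bsub>N\<^esub> C"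
  by (auto simp: trunc_mult_def fun_eq_iff matrix_mul_diff_left sum_subtractf)

lemma trunc_mult_diff_right: "A \<star>\<^bsub>N\<^esub> (B - C) = A \<star>\<^bsub>N\<^esub> B - A \<star>\<^bsub>N\<^esub> C"
  by (auto simp: trunc_mult_def fun_eq_iff matrix_mul_diff_right sum_subtractf)

text \<open>Coefficient k of a product involves only coefficients of index at most k, so below N
  truncation discards nothing, and both sides sum over all triples of indices with total k.\<close>

lemma trunc_mult_assoc: "A \<star>\<^bsub>N\<^esub> B \<star>\<^bsub>N\<^esub> C = A \<star>\<^bsub>N\<^esub> (B \<star>\<^bsub>N\<^esub> C)"
proof
  fix k
  show "(A \<star>\<^bsub>N\<^esub> B \<star>\<^bsub>N\<^esub> C) k = (A \<star>\<^bsub>N\<^esub> (B \<star>\<^bsub>N\<^esub> C)) k"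
  proof (cases "k < N")
    case True
    have "(A \<star>\<^bsub>N\<^esub> B \<star>\<^bsub>N\<^esub> C) k = (\<Sum>l\<le>k. \<Sum>m\<le>l. A m ** B (l - m) ** C (k - l))"
      using True by (simp add: trunc_mult_def matrix_mul_sum_left)
    also have "\<dots> = (\<Sum>l\<le>k. \<Sum>m\<le>k - l. A l ** B m ** C (k - l - m))"
      \<comment> \<open>The reindexing behind associativity of formal power series, applied to an
        arbitrary function of three indices.\<close>
      using fps_mult_assoc_lemma[where k = k and f = "\<lambda>a b c. A a ** B b ** C c"]
      by (simp add: atLeast0AtMost)
    also have "\<dots> = (A \<star>\<^bsub>N\<^esub> (B \<star>\<^bsub>N\<^esub> C)) k"
      using True by (simp add: trunc_mult_def matrix_mul_sum_right matrix_mul_assoc less_imp_diff_less)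
    finally show ?thesis .
  qed (simp add: trunc_mult_def)
qed

lemma trunc_mult_e0_left: "A \<in> trunc_polys N \<Longrightarrow> e0 \<star>\<^bsub>N\<^esub> A = A"
  by (auto simp: trunc_mult_def trunc_polys_def e0_def fun_eq_iff if_distrib[of "\<lambda>M. M ** _"] sum.delta
           cong: if_cong)

lemma trunc_mult_e0_right:
  assumes "A \<in> trunc_polys N"
  shows "A \<star>\<^bsub>N\<^esub> e0 = A"
proof
  fix k
  have "(\<Sum>l\<le>k. A l ** e0 (k - l)) = (\<Sum>l\<le>k. if l = k then A l else 0)"
    by (rule sum.cong) (auto simp: e0_def)
  then show "(A \<star>\<^bsub>N\<^esub> e0) k = A k"
    using assms by (simp add: trunc_mult_def trunc_polys_def)
qed

text \<open>The recursion solves \<open>A * B = e0\<close> coefficient by coefficient, assuming \<open>A 0 = mat 1\<close>.\<close>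

fun right_inv :: "(nat \<Rightarrow> complex ^ 's ^ 's) \<Rightarrow> nat \<Rightarrow> complex ^ 's ^ 's" where
  "right_inv A k = (if k = 0 then mat 1 else - (\<Sum>l<k. A (k - l) ** right_inv A l))"

declare right_inv.simps [simp del]

text \<open>The conclusion records \<open>B 0 = mat 1\<close> so that the lemma can be applied again
  to \<open>B\<close> itself.\<close>

lemma trunc_right_inverse_exists:
  assumes "A 0 = mat 1" "N \<ge> 1"
  shows "\<exists>B \<in> trunc_polys N. B 0 = mat 1 \<and> A \<star>\<^bsub>N\<^esub> B = e0"
proof -
  define B where "B k = (if k < N then right_inv A k else 0)" for k
  have "(A \<star>\<^bsub>N\<^esub> B) k = e0 k" for k
  proof (cases "k < N")
    case True
    \<comment> \<open>Reversing the order of summation matches the shape of the recursion.\<close>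
    have "(A \<star>\<^bsub>N\<^esub> B) k = (\<Sum>l\<le>k. A (k - l) ** B l)"
      using True sum.nat_diff_reindex[of "\<lambda>l. A l ** B (k - l)" "Suc k"]
      by (simp add: trunc_mult_def lessThan_Suc_atMost)
    also have "\<dots> = (\<Sum>l\<le>k. A (k - l) ** right_inv A l)"
      using True by (intro sum.cong) (auto simp: B_def)
    \<comment> \<open>The term l = k carries the factor \<open>A 0 = mat 1\<close>; the recursion
      chooses \<open>right_inv A k\<close> to cancel the remaining terms when k > 0.\<close>
    also have "\<dots> = (\<Sum>l<k. A (k - l) ** right_inv A l) + right_inv A k"
      by (simp add: assms lessThan_Suc_atMost[symmetric])
    also have "\<dots> = e0 k"
      by (simp add: e0_def right_inv.simps[of A k])
    finally show ?thesis .
  \<comment> \<open>Here k \<ge> N \<ge> 1, so k is not 0 and \<open>e0 k\<close> vanishes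
    too.\<close>
  qed (use assms in \<open>auto simp: trunc_mult_def e0_def\<close>)
  moreover have "B 0 = mat 1" "B \<in> trunc_polys N"
    using assms by (auto simp: B_def right_inv.simps trunc_polys_def)
  ultimately show ?thesis by blast
qed

lemma trunc_inv_props:
  assumes A: "A \<in> trunc_polys N" "A 0 = mat 1" and N: "N \<ge> 1"
  shows "trunc_inv N A \<in> trunc_polys N" "A \<star>\<^bsub>N\<^esub> trunc_inv N A = e0" "trunc_inv N A \<star>\<^bsub>N\<^esub> A = e0"
proof -
  obtain B where B: "B \<in> trunc_polys N" "B 0 = mat 1" "A \<star>\<^bsub>N\<^esub> B = e0"
    using trunc_right_inverse_exists[of A N] A N by blast
  obtain C where C: "C \<in> trunc_polys N" "B \<star>\<^bsub>N\<^esub> C = e0"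
    using trunc_right_inverse_exists[of B N] B N by blast
  \<comment> \<open>A right inverse of a right inverse of \<open>A\<close> is \<open>A\<close>, so \<open>B\<close> is two-sided.\<close>
  have "A = C"
    by (metis A(1) B(3) C trunc_mult_assoc trunc_mult_e0_left trunc_mult_e0_right)
  then have "B \<in> trunc_polys N \<and> A \<star>\<^bsub>N\<^esub> B = e0 \<and> B \<star>\<^bsub>N\<^esub> A = e0"
    using B C by simp
  \<comment> \<open>Uniqueness, as required by the definite description: B' = B' \<star> (A \<star>
    B) = (B' \<star> A) \<star> B = B.\<close>
  moreover have "B' = B" if "B' \<in> trunc_polys N \<and> A \<star>\<^bsub>N\<^esub> B' = e0 \<and> B' \<star>\<^bsub>N\<^esub> A = e0" for B'
    by (metis B(1,3) that trunc_mult_assoc trunc_mult_e0_left trunc_mult_e0_right)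
  ultimately have "trunc_inv N A \<in> trunc_polys N \<and> A \<star>\<^bsub>N\<^esub> trunc_inv N A = e0
      \<and> trunc_inv N A \<star>\<^bsub>N\<^esub> A = e0"
    unfolding trunc_inv_def by (rule theI)
  then show "trunc_inv N A \<in> trunc_polys N" "A \<star>\<^bsub>N\<^esub> trunc_inv N A = e0" "trunc_inv N A \<star>\<^bsub>N\<^esub> A = e0"
    by auto
qed

text \<open>Real linearity on a finite-dimensional space already gives boundedness, which is what
  the general facts about \<open>onorm\<close> ask for.\<close>

lemma bounded_linear_matrix_vector_mul:
  fixes A :: "complex ^ 'p ^ 'r"
  shows "bounded_linear (\<lambda>v. A *v v)"
proof (rule linear_conv_bounded_linear[THEN iffD1], rule linearI)
  show "A *v (x + y) = A *v x + A *v y" for x y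
    by (rule matrix_vector_right_distrib)
  show "A *v (c *\<^sub>R x) = c *\<^sub>R (A *v x)" for c x
    by (simp add: matrix_vector_mult_def vec_eq_iff scaleR_sum_right)
qed

lemma spectral_norm_nonneg: "spectral_norm A \<ge> 0"
  unfolding spectral_norm_def by (rule onorm_pos_le[OF bounded_linear_matrix_vector_mul])

lemma spectral_norm_0 [simp]: "spectral_norm 0 = 0"
  by (simp add: spectral_norm_def onorm_zero)

lemma spectral_norm_mult: "spectral_norm (A ** B) \<le> spectral_norm A * spectral_norm B"
  using onorm_compose[OF bounded_linear_matrix_vector_mul[of A] bounded_linear_matrix_vector_mul[of B]]
  by (simp add: spectral_norm_def o_def matrix_vector_mul_assoc)

lemma spectral_norm_triangle: "spectral_norm (A + B) \<le> spectral_norm A + spectral_norm B"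
  using onorm_triangle[OF bounded_linear_matrix_vector_mul[of A] bounded_linear_matrix_vector_mul[of B]]
  by (simp add: spectral_norm_def matrix_vector_mult_add_rdistrib)

lemma spectral_norm_sum: "spectral_norm (\<Sum>i\<in>S. A i) \<le> (\<Sum>i\<in>S. spectral_norm (A i))"
  by (induction S rule: infinite_finite_induct)
     (auto intro: order_trans[OF spectral_norm_triangle])

lemma norm1_nonneg: "norm1 N A \<ge> 0"
  by (simp add: norm1_def sum_nonneg spectral_norm_nonneg)

lemma norm1_triangle: "norm1 N (\<lambda>k. A k + B k) \<le> norm1 N A + norm1 N B"
  by (simp add: norm1_def sum.distrib[symmetric] sum_mono spectral_norm_triangle)

text \<open>The Cauchy product of the two norm sequences runs over the triangle i + j < N, which
  lies in the square of all i, j < N; the terms are nonnegative, and the sum over the square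
  factors.\<close>

lemma norm1_mult: "norm1 N (A \<star>\<^bsub>N\<^esub> B) \<le> norm1 N A * norm1 N B"
proof -
  let ?f = "\<lambda>i j. spectral_norm (A i) * spectral_norm (B j)"
  have "spectral_norm ((A \<star>\<^bsub>N\<^esub> B) k) \<le> (\<Sum>l\<le>k. ?f l (k - l))" if "k < N" for k
    using that
    by (auto simp: trunc_mult_def intro!: order_trans[OF spectral_norm_sum] sum_mono spectral_norm_mult)
  then have "norm1 N (A \<star>\<^bsub>N\<^esub> B) \<le> (\<Sum>k<N. \<Sum>l\<le>k. ?f l (k - l))"
    unfolding norm1_def by (intro sum_mono) auto
  also have "\<dots> = (\<Sum>(i, j)\<in>{(i, j). i + j < N}. ?f i j)"
    by (rule sum.triangle_reindex[symmetric])
  also have "\<dots> \<le> (\<Sum>(i, j)\<in>{..<N} \<times> {..<N}. ?f i j)"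
    by (rule sum_mono2) (auto simp: spectral_norm_nonneg)
  also have "\<dots> = norm1 N A * norm1 N B"
    by (simp add: norm1_def sum_product sum.cartesian_product)
  finally show ?thesis .
qed

theorem proposition2p5:
  fixes N :: nat
    and q q' \<psi> \<psi>' :: "nat \<Rightarrow> complex ^ 's ^ 's"
    and L L' M M' :: "nat \<Rightarrow> complex ^ 'd ^ 's"
  assumes "N \<ge> 1"
    and "q \<in> trunc_polys N" and "q' \<in> trunc_polys N"
    and "q 0 = 0" and "q' 0 = 0"
    and "\<psi> = trunc_inv N (e0 - q)" and "\<psi>' = trunc_inv N (e0 - q')"
    and "L \<in> trunc_polys N" and "L' \<in> trunc_polys N"
    and "M = \<psi> \<star>\<^bsub>N\<^esub> L" and "M' = \<psi>' \<star>\<^bsub>N\<^esub> L'"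
  shows "\<psi>' - \<psi> = \<psi>' \<star>\<^bsub>N\<^esub> (q' - q) \<star>\<^bsub>N\<^esub> \<psi>
    \<and> norm1 N (\<psi>' - \<psi>) \<le> norm1 N \<psi>' * norm1 N (q' - q) * norm1 N \<psi>
    \<and> norm1 N (M' - M) \<le> norm1 N (\<psi>' - \<psi>) * norm1 N L + norm1 N \<psi>' * norm1 N (L' - L)"
proof -
  have unit: "e0 - r \<in> trunc_polys N" "(e0 - r) 0 = mat 1"
    if "r \<in> trunc_polys N" "r 0 = 0" for r :: "nat \<Rightarrow> complex ^ 's ^ 's"
    using that assms(1) by (auto simp: trunc_polys_def e0_def)
  have \<psi>: "\<psi> \<in> trunc_polys N" "(e0 - q) \<star>\<^bsub>N\<^esub> \<psi> = e0"
    using trunc_inv_props[OF unit[OF assms(2,4)] assms(1)] by (simp_all only: assms(6))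
  have \<psi>': "\<psi>' \<in> trunc_polys N" "\<psi>' \<star>\<^bsub>N\<^esub> (e0 - q') = e0"
    using trunc_inv_props[OF unit[OF assms(3,5)] assms(1)] by (simp_all only: assms(7))
  \<comment> \<open>The unit is inserted in two ways: after \<psi>' as \<open>e0 - q\<close> times
    \<psi>, and before \<psi> as \<psi>' times \<open>e0 - q'\<close>.\<close>
  have "\<psi>' - \<psi> = \<psi>' \<star>\<^bsub>N\<^esub> ((e0 - q) \<star>\<^bsub>N\<^esub> \<psi>) - \<psi>' \<star>\<^bsub>N\<^esub> (e0 - q') \<star>\<^bsub>N\<^esub> \<psi>"
    by (simp only: \<psi> \<psi>' trunc_mult_e0_left trunc_mult_e0_right)
  also have "\<dots> = \<psi>' \<star>\<^bsub>N\<^esub> ((e0 - q) - (e0 - q')) \<star>\<^bsub>N\<^esub> \<psi>"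
    by (simp only: trunc_mult_assoc[symmetric] trunc_mult_diff_left trunc_mult_diff_right)
  also have "(e0 - q) - (e0 - q') = q' - q"
    by (simp add: fun_eq_iff)
  finally have resolvent: "\<psi>' - \<psi> = \<psi>' \<star>\<^bsub>N\<^esub> (q' - q) \<star>\<^bsub>N\<^esub> \<psi>" .
  have "norm1 N (\<psi>' - \<psi>) \<le> norm1 N (\<psi>' \<star>\<^bsub>N\<^esub> (q' - q)) * norm1 N \<psi>"
    unfolding resolvent by (rule norm1_mult)
  also have "\<dots> \<le> norm1 N \<psi>' * norm1 N (q' - q) * norm1 N \<psi>"
    by (intro mult_right_mono norm1_mult norm1_nonneg)
  finally have "norm1 N (\<psi>' - \<psi>) \<le> norm1 N \<psi>' * norm1 N (q' - q) * norm1 N \<psi>" .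
  \<comment> \<open>The mixed product of \<psi>' and L is subtracted and added.\<close>
  moreover have "M' - M = (\<lambda>k. ((\<psi>' - \<psi>) \<star>\<^bsub>N\<^esub> L) k + (\<psi>' \<star>\<^bsub>N\<^esub> (L' - L)) k)"
    by (simp add: fun_eq_iff assms(10,11) trunc_mult_diff_left trunc_mult_diff_right)
  then have "norm1 N (M' - M) \<le> norm1 N (\<psi>' - \<psi>) * norm1 N L + norm1 N \<psi>' * norm1 N (L' - L)"
    using norm1_triangle[of N "(\<psi>' - \<psi>) \<star>\<^bsub>N\<^esub> L" "\<psi>' \<star>\<^bsub>N\<^esub> (L' - L)"]
      norm1_mult[of N "\<psi>' - \<psi>" L] norm1_mult[of N \<psi>' "L' - L"] by simp
  ultimately show ?thesis
    using resolvent by blast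
qed

end
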